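(* For all integers $d,n\ge 0$ the map $\mathrm{pe}:\mathrm{dA}_n\to \mathrm{Av}_n(\sigma_{d+3})$ is an injection.
   Context: $d$-ascent sequences. For a sequence $\alpha=a_1a_2\ldots a_n$ of nonnegative integers and $d\ge 0$, an index $k\in\{1,\dots,n-1\}$ is a $d$-ascent of $\alpha$ if $a_{k+1}>a_k-d$; $\mathrm{dasc}\,\alpha$ is the number of $d$-ascents of $\alpha$. Write $\alpha_k=a_1\ldots a_k$. The sequence $\alpha$ is a $d$-ascent sequence if $a_1=0$ and $a_{k+1}\le 1+\mathrm{dasc}\,\alpha_k$ for $k\in\{1,\dots,n-1\}$. $\mathrm{dA}_n$ is the set of $d$-ascent sequences of length $n$ (for $n=0$, just the empty sequence). The pattern $\sigma_{d+3}$. A permutation $\pi=p_1\ldots p_n$ of $\{1,\dots,n\}$ (one-line notation) contains the bivincular pattern $\sigma_{d+3}=(d+2)\,|\,(d+3)\;1\;2\;\ldots\;\overline{(d+1)}$ if there are indices $i$ and $i+1<j_1<j_2<\dots<j_{d+1}$ with $p_i<p_{i+1}$, $p_{j_1}<p_{j_2}<\dots<p_{j_{d+1}}$, and $p_{j_{d+1}}=p_i-1$; otherwise $\pi$ avoids it. $\mathrm{Av}_n(\sigma_{d+3})$ is the set of permutations of $\{1,\dots,n\}$ avoiding $\sigma_{d+3}$. Active sites. For $\pi\in \mathrm{Av}_n(\sigma_{d+3})$ consider its $n+1$ spaces (before $p_1$, between adjacent elements, after $p_n$). A space is an active site if inserting $n+1$ there yields a permutation still avoiding $\sigma_{d+3}$.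 The active sites are numbered $0,1,2,\dots$ from left to right. The empty permutation has one active site, labelled $0$. The map $\mathrm{pe}$. For $\alpha=a_1\ldots a_n\in \mathrm{dA}_n$, construct permutations $\emptyset=\pi_0,\pi_1,\dots,\pi_n=\mathrm{pe}(\alpha)$, where $\pi_k$ is obtained from $\pi_{k-1}$ by inserting $k$ in the active site of $\pi_{k-1}$ labelled $a_k$, for $1\le k\le n$. (Part of the assertion is that this map is well defined.) *)

theory Defs
  imports Main "HOL-Combinatorics.Multiset_Permutations"
begin

text \<open>
  The sequence \<open>a_1 ... a_n\<close> is the list with \<open>\<alpha> ! (k - 1) = a_k\<close>. The indices \<open>k\<close> below keep the
  usual range \<open>1, ..., n - 1\<close>, so \<open>a_k\<close> is \<open>\<alpha> ! (k - 1)\<close> and \<open>a_(k+1)\<close> is \<open>\<alpha> ! k\<close>. The comparison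
  is made in the integers because \<open>a_k - d\<close> may be negative.
\<close>

definition dasc :: "nat \<Rightarrow> nat list \<Rightarrow> nat" where
  "dasc d \<alpha> = card {k \<in> {1..<length \<alpha>}. int (\<alpha> ! k) > int (\<alpha> ! (k - 1)) - int d}"

definition d_ascent_seq :: "nat \<Rightarrow> nat list \<Rightarrow> bool" where
  "d_ascent_seq d \<alpha> \<longleftrightarrow>
     (\<alpha> \<noteq> [] \<longrightarrow> hd \<alpha> = 0) \<and>
     (\<forall>k\<in>{1..<length \<alpha>}. \<alpha> ! k \<le> 1 + dasc d (take k \<alpha>))"

definition dA :: "nat \<Rightarrow> nat \<Rightarrow> nat list set" where
  "dA d n = {\<alpha>. length \<alpha> = n \<and> d_ascent_seq d \<alpha>}"

text \<open>
  Permutations of \<open>{1..n}\<close> are lists in one-line notation. List positions are 0-based, and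
  \<open>j 0 < ... < j d\<close> are the positions of the \<open>d + 1\<close> entries playing the roles
  \<open>1, 2, ..., d + 1\<close> of the pattern.
\<close>

definition contains_sigma :: "nat \<Rightarrow> nat list \<Rightarrow> bool" where
  "contains_sigma d p \<longleftrightarrow>
     (\<exists>i (j :: nat \<Rightarrow> nat).
        i + 1 < j 0 \<and> strict_mono_on {0..d} j \<and> j d < length p \<and>
        p ! i < p ! (i + 1) \<and>
        strict_mono_on {0..d} (\<lambda>m. p ! j m) \<and>
        p ! j d + 1 = p ! i)"

definition Av :: "nat \<Rightarrow> nat \<Rightarrow> nat list set" where
  "Av d n = {p \<in> permutations_of_set {1..n}. \<not> contains_sigma d p}"

text \<open>
  Space \<open>s\<close> of \<open>p\<close> is the one with exactly \<open>s\<close> entries of \<open>p\<close> to its left,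
  for \<open>0 \<le> s \<le> length p\<close>.
\<close>

definition insert_new_max :: "nat list \<Rightarrow> nat \<Rightarrow> nat list" where
  "insert_new_max p s = take s p @ [length p + 1] @ drop s p"

definition active_sites :: "nat \<Rightarrow> nat list \<Rightarrow> nat set" where
  "active_sites d p = {s. s \<le> length p \<and> \<not> contains_sigma d (insert_new_max p s)}"

text \<open>
  The construction is partial: the result is \<open>None\<close> when there is no active site with the required label.
\<close>

definition insert_at_label :: "nat \<Rightarrow> nat list \<Rightarrow> nat \<Rightarrow> nat list option" where
  "insert_at_label d p a =
     (if a < card (active_sites d p)
      then Some (insert_new_max p (sorted_list_of_set (active_sites d p) ! a))
      else None)"

definition pe :: "nat \<Rightarrow> nat list \<Rightarrow> nat list option" where
  "pe d \<alpha> = foldl (\<lambda>r a. Option.bind r (\<lambda>p. insert_at_label d p a)) (Some []) \<alpha>"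

end

theory Submission
  imports Defs
begin

text \<open>
  An avoider is extended by placing a new maximum in one of its active sites, so the statement is
  about how many active sites there are and how they are labelled.

  Call an entry \<open>v\<close> blocked if an increasing subsequence of length \<open>d + 1\<close> ending in the value
  \<open>v - 1\<close> lies to its right. A permutation contains the pattern iff some blocked entry is followed
  by a larger one (\<open>contains_sigma_iff_blocked_ascent\<close>). A new maximum is larger than any
  neighbour, so the active sites of an avoider are the front and the spaces just behind an unblocked
  entry (\<open>active_sites_iff\<close>). Whether \<open>v\<close> is blocked depends only on how the entries up to \<open>v\<close> are
  arranged among themselves, so later insertions do not change it. Hence an insertion keeps all active sites to the left of the new
  entry, together with their labels, and the number of active sites grows by one exactly
  if the new entry is unblocked.

  It remains to see that a \<open>d\<close>-ascent \<open>a_(k+1) > a_k - d\<close> makes the new entry \<open>k + 1\<close> unblocked.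
  Suppose that \<open>k + 1\<close> is blocked, by \<open>x_0 < ... < x_d = k\<close> to its right. Between \<open>x_m\<close> and
  \<open>x_(m+1)\<close> the permutation has an ascent, whose bottom is unblocked because the permutation
  avoids the pattern. This gives \<open>d\<close> active sites between \<open>k + 1\<close> and \<open>k\<close>, and together with the
  site that receives \<open>k + 1\<close> it follows that \<open>a_(k+1) + d \<le> a_k\<close>
  (\<open>labels_if_blocked_by_previous_max\<close>). So \<open>\<pi>_k\<close> has at least \<open>2 + dasc \<alpha>_k\<close> active sites, which
  are enough for every admissible letter \<open>a_(k+1)\<close>. There may be strictly more:
  for \<open>d = 2\<close> and \<open>\<alpha> = 0, 0, 0, 3, 0\<close> the permutation \<open>5 3 2 1 4\<close> has six active sites while
  \<open>2 + dasc \<alpha> = 5\<close>. This is why the map is in general not onto.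

  Injectivity holds because deleting the maximum undoes an insertion.
\<close>

section \<open>Blocked entries\<close>

definition blocked :: "nat \<Rightarrow> nat list \<Rightarrow> nat \<Rightarrow> bool" where
  "blocked d p i \<longleftrightarrow>
     (\<exists>j :: nat \<Rightarrow> nat. i < j 0 \<and> strict_mono_on {0..d} j \<and> j d < length p \<and>
        strict_mono_on {0..d} (\<lambda>m. p ! j m) \<and> p ! j d + 1 = p ! i)"

text \<open>
  The blocking entries are smaller than \<open>p ! i\<close> while the entry following it is larger. So they
  all lie beyond that entry, as the pattern demands.
\<close>

lemma contains_sigma_iff_blocked_ascent:
  "contains_sigma d p \<longleftrightarrow> (\<exists>i. p ! i < p ! (i + 1) \<and> blocked d p i)"
proof
  assume "contains_sigma d p"
  then show "\<exists>i. p ! i < p ! (i + 1) \<and> blocked d p i"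
    unfolding contains_sigma_def blocked_def using add_lessD1 by blast
next
  assume "\<exists>i. p ! i < p ! (i + 1) \<and> blocked d p i"
  then obtain i j where ij: "p ! i < p ! (i + 1)" "i < j 0" "strict_mono_on {0..d} j"
      "j d < length p" "strict_mono_on {0..d} (\<lambda>m. p ! j m)" "p ! j d + 1 = p ! i"
    unfolding blocked_def by blast
  have "p ! j 0 \<le> p ! j d"
    using strict_mono_on_leD[OF ij(5), of 0 d] by simp
  then have "j 0 \<noteq> i + 1" using ij by auto
  then have "i + 1 < j 0" using ij(2) by simp
  then show "contains_sigma d p" unfolding contains_sigma_def using ij by blast
qed

section \<open>Inserting a new maximum\<close>

text \<open>The order embedding of the naturals whose range omits exactly \<open>s\<close>.\<close>

definition skip :: "nat \<Rightarrow> nat \<Rightarrow> nat" where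
  "skip s i = (if i < s then i else i + 1)"

lemma skip_less_iff [simp]: "skip s i < skip s j \<longleftrightarrow> i < j"
  by (auto simp: skip_def)

lemma skip_eq_iff [simp]: "skip s i = skip s j \<longleftrightarrow> i = j"
  by (auto simp: skip_def)

lemma skip_neq [simp]: "skip s i \<noteq> s"
  by (auto simp: skip_def)

lemma skip_less_Suc_iff [simp]:
  "s \<le> n \<Longrightarrow> skip s i < Suc n \<longleftrightarrow> i < n"
  by (auto simp: skip_def)

lemma skip_exhaust:
  assumes "i \<noteq> s"
  obtains i' where "i = skip s i'"
proof (cases "i < s")
  case True
  then show ?thesis using that[of i] by (simp add: skip_def)
next
  case False
  then show ?thesis using that[of "i - 1"] assms by (simp add: skip_def)
qed

lemma length_insert_new_max [simp]:
  "s \<le> length p \<Longrightarrow> length (insert_new_max p s) = length p + 1"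
  by (simp add: insert_new_max_def)

lemma insert_new_max_nth_same [simp]:
  "s \<le> length p \<Longrightarrow> insert_new_max p s ! s = length p + 1"
  by (simp add: insert_new_max_def nth_append)

lemma insert_new_max_nth_skip [simp]:
  "s \<le> length p \<Longrightarrow> i < length p \<Longrightarrow> insert_new_max p s ! skip s i = p ! i"
  by (auto simp: insert_new_max_def nth_append skip_def min_def nth_Cons' Suc_diff_le)

lemma insert_new_max_permutation:
  assumes "p \<in> permutations_of_set {1..n}" "s \<le> n"
  shows "insert_new_max p s \<in> permutations_of_set {1..Suc n}"
proof -
  have sp: "set p = {1..n}" and dp: "distinct p" and len: "length p = n"
    using assms(1) by (auto simp: permutations_of_set_def dest: distinct_card)
  have td: "set (take s p) \<union> set (drop s p) = {1..n}"
    using sp by (metis append_take_drop_id set_append)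
  have "set (insert_new_max p s) = {1..Suc n}"
    using td len by (auto simp: insert_new_max_def atLeastAtMostSuc_conv)
  moreover have "distinct (insert_new_max p s)"
  proof -
    have "Suc n \<notin> set (take s p)" "Suc n \<notin> set (drop s p)"
      using sp by (auto dest: in_set_takeD in_set_dropD)
    moreover have "distinct (take s p @ drop s p)" using dp by simp
    ultimately show ?thesis
      unfolding insert_new_max_def distinct_append using len by auto
  qed
  ultimately show ?thesis by (simp add: permutations_of_set_def)
qed

lemma insert_new_max_inject:
  assumes "insert_new_max p s = insert_new_max q t" "length p = length q"
    and "s \<le> length p" "t \<le> length q" "length p + 1 \<notin> set p" "length p + 1 \<notin> set q"
  shows "p = q \<and> s = t"
proof -
  have "take s p @ (length p + 1) # drop s p = take t q @ (length p + 1) # drop t q"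
    using assms(1,2) by (simp add: insert_new_max_def)
  moreover have "length p + 1 \<notin> set (take s p)" "length p + 1 \<notin> set (drop s p)"
    using assms(5) by (meson in_set_takeD in_set_dropD)+
  ultimately have eq: "take s p = take t q" "drop s p = drop t q"
    by (auto simp: append_Cons_eq_iff)
  then have "p = q" by (metis append_take_drop_id)
  moreover have "s = t" using arg_cong[OF eq(1), of length] assms(3,4) by simp
  ultimately show ?thesis by simp
qed

text \<open>
  A new maximum takes no part in blocking an older entry, since blocking entries are smaller than
  the entry they block.
\<close>

lemma blocked_insert_new_max_skip [simp]:
  assumes le: "\<forall>x\<in>set p. x \<le> length p" and s: "s \<le> length p" and i: "i < length p"
  shows "blocked d (insert_new_max p s) (skip s i) \<longleftrightarrow> blocked d p i"
proof
  assume "blocked d p i"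
  then obtain j where j: "i < j 0" "strict_mono_on {0..d} j"
      "j d < length p" "strict_mono_on {0..d} (\<lambda>m. p ! j m)" "p ! j d + 1 = p ! i"
    unfolding blocked_def by blast
  have jm: "j m < length p" if "m \<in> {0..d}" for m
    using strict_mono_on_leD[OF j(2) that, of d] that j(3) by simp
  have val: "insert_new_max p s ! skip s (j m) = p ! j m" if "m \<in> {0..d}" for m
    using jm[OF that] s by simp
  have "skip s i < skip s (j 0)" using j by simp
  moreover have "strict_mono_on {0..d} (\<lambda>m. skip s (j m))"
    using j(2) by (simp add: strict_mono_on_def)
  moreover have "skip s (j d) < length (insert_new_max p s)" using s j(3) by simp
  moreover have "strict_mono_on {0..d} (\<lambda>m. insert_new_max p s ! skip s (j m))"
    using j(4) val by (simp add: strict_mono_on_def)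
  moreover have "insert_new_max p s ! skip s (j d) + 1 = insert_new_max p s ! skip s i"
    using s i j(3,5) by simp
  ultimately show "blocked d (insert_new_max p s) (skip s i)"
    unfolding blocked_def by (intro exI[of _ "\<lambda>m. skip s (j m)"]) simp
next
  let ?q = "insert_new_max p s"
  assume "blocked d ?q (skip s i)"
  then obtain j where j: "skip s i < j 0" "strict_mono_on {0..d} j"
      "j d < length ?q" "strict_mono_on {0..d} (\<lambda>m. ?q ! j m)" "?q ! j d + 1 = ?q ! skip s i"
    unfolding blocked_def by blast
  have pi: "p ! i \<le> length p" using le i by simp
  have ne: "j m \<noteq> s" if "m \<in> {0..d}" for m
  proof -
    have "?q ! j m \<le> ?q ! j d"
      using strict_mono_on_leD[OF j(4) that, of d] that by simp
    then show ?thesis using pi j(5) s i by auto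
  qed
  then have "\<forall>m\<in>{0..d}. \<exists>i'. j m = skip s i'"
    by (meson skip_exhaust)
  then obtain j' where j': "\<And>m. m \<in> {0..d} \<Longrightarrow> j m = skip s (j' m)" by metis
  have jd: "j' d < length p" using j(3) j'[of d] s by simp
  have mono: "strict_mono_on {0..d} j'"
    using j(2) j' by (simp add: strict_mono_on_def)
  have jm: "j' m < length p" if "m \<in> {0..d}" for m
    using strict_mono_on_leD[OF mono that, of d] that jd by simp
  have val: "?q ! j m = p ! j' m" if "m \<in> {0..d}" for m
    using jm[OF that] s j'[OF that] by simp
  have "i < j' 0" using j(1) j'[of 0] by simp
  moreover have "strict_mono_on {0..d} (\<lambda>m. p ! j' m)"
    using j(4) val by (simp add: strict_mono_on_def)
  moreover have "p ! j' d + 1 = p ! i" using j(5) val[of d] s i by simp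
  ultimately show "blocked d p i"
    unfolding blocked_def using mono jd by blast
qed

section \<open>Active sites\<close>

lemma Av_permutation:
  assumes "p \<in> Av d n"
  shows "set p = {1..n}" "distinct p" "length p = n" "\<forall>x\<in>set p. x \<le> length p"
proof -
  show *: "set p = {1..n}" "distinct p"
    using assms by (auto simp: Av_def permutations_of_set_def)
  show "length p = n" using distinct_card[OF *(2)] *(1) by simp
  then show "\<forall>x\<in>set p. x \<le> length p" using * by simp
qed

lemma active_sites_iff:
  assumes "p \<in> Av d n"
  shows "s \<in> active_sites d p \<longleftrightarrow> s \<le> n \<and> (s = 0 \<or> \<not> blocked d p (s - 1))"
proof -
  note P = Av_permutation[OF assms]
  have "contains_sigma d (insert_new_max p s) \<longleftrightarrow> s \<noteq> 0 \<and> blocked d p (s - 1)"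
    if s: "s \<le> n"
  proof
    assume "contains_sigma d (insert_new_max p s)"
    then obtain i where i: "insert_new_max p s ! i < insert_new_max p s ! (i + 1)"
        "blocked d (insert_new_max p s) i"
      unfolding contains_sigma_iff_blocked_ascent by blast
    let ?q = "insert_new_max p s"
    have il: "i + 1 < length ?q"
    proof -
      \<comment> \<open>The blocking entries lie to the right of position \<open>i\<close>, so there is a next position.\<close>
      obtain j where j: "i < j 0" "strict_mono_on {0..d} j" "j d < length ?q"
        using i(2) unfolding blocked_def by blast
      then have "j 0 \<le> j d" using strict_mono_on_leD[OF j(2), of 0 d] by simp
      then show ?thesis using j by simp
    qed
    have le: "?q ! m \<le> n + 1" if "m < length ?q" for m
    proof (cases "m = s")
      case True
      then show ?thesis using s P by simp
    next
      case False
      then obtain m' where m': "m = skip s m'" by (rule skip_exhaust)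
      then have "m' < length p" using that s P by simp
      then show ?thesis using m' s P nth_mem[of m' p] by fastforce
    qed
    have "i \<noteq> s"
      using i(1) le[OF il] s P by auto
    show "s \<noteq> 0 \<and> blocked d p (s - 1)"
    proof (cases "i + 1 = s")
      case True
      then have "i = skip s (s - 1)" by (auto simp: skip_def)
      moreover have "s - 1 < length p" using True s P by simp
      ultimately show ?thesis using i(2) True s P by (metis blocked_insert_new_max_skip add_is_0 one_neq_zero)
    next
      case False
      obtain i' where i': "i = skip s i'" using \<open>i \<noteq> s\<close> by (rule skip_exhaust)
      have Suc_i': "i + 1 = skip s (i' + 1)"
        using i' False by (auto simp: skip_def split: if_splits)
      have l: "i' + 1 < length p"
        using il s P skip_less_Suc_iff[of s n "i' + 1"] unfolding Suc_i' by simp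
      have "p ! i' < p ! (i' + 1)" using i(1) l s P unfolding Suc_i' unfolding i' by simp
      moreover have "blocked d p i'" using i(2) l s P i' by simp
      ultimately have "contains_sigma d p" unfolding contains_sigma_iff_blocked_ascent by blast
      then show ?thesis using assms by (simp add: Av_def)
    qed
  next
    assume b: "s \<noteq> 0 \<and> blocked d p (s - 1)"
    then have l: "s - 1 < length p" "skip s (s - 1) = s - 1" using s P by (auto simp: skip_def)
    then have "blocked d (insert_new_max p s) (s - 1)"
      using b s P blocked_insert_new_max_skip[of p s "s - 1" d] by simp
    moreover have "insert_new_max p s ! (s - 1) = p ! (s - 1)"
      using l s P insert_new_max_nth_skip[of s p "s - 1"] by simp
    moreover have "p ! (s - 1) \<le> n" using P l nth_mem[of "s - 1" p] by fastforce
    ultimately show "contains_sigma d (insert_new_max p s)"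
      unfolding contains_sigma_iff_blocked_ascent using s P b by (intro exI[of _ "s - 1"]) simp
  qed
  then show ?thesis unfolding active_sites_def using P(3) by auto
qed

lemma finite_active_sites [simp]: "finite (active_sites d p)"
  by (rule finite_subset[of _ "{..length p}"]) (auto simp: active_sites_def)

lemma insert_at_active_site_in_Av:
  assumes "p \<in> Av d n" "t \<in> active_sites d p"
  shows "insert_new_max p t \<in> Av d (Suc n)"
proof -
  have "t \<le> n" using assms active_sites_iff by blast
  then show ?thesis
    using assms insert_new_max_permutation[of p n t] by (simp add: Av_def active_sites_def)
qed

text \<open>
  An old site \<open>s\<close> becomes site \<open>skip (t + 1) s\<close>. The space that received the new entry keeps the
  number \<open>t\<close>, since it survives as the space just before that entry; the space just behind the new
  entry is the only one without an old counterpart.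
\<close>

lemma active_sites_insert_new_max:
  assumes p: "p \<in> Av d n" and t: "t \<in> active_sites d p"
  shows "active_sites d (insert_new_max p t) =
           skip (t + 1) ` active_sites d p \<union> (if blocked d (insert_new_max p t) t then {} else {t + 1})"
proof -
  let ?q = "insert_new_max p t"
  note P = Av_permutation[OF p]
  have tn: "t \<le> n" using t p active_sites_iff by blast
  have q: "?q \<in> Av d (Suc n)" using insert_at_active_site_in_Av[OF p t] .
  have old: "skip (t + 1) s \<in> active_sites d ?q \<longleftrightarrow> s \<in> active_sites d p" for s
  proof (cases s)
    case 0
    then show ?thesis by (simp add: active_sites_iff[OF q] active_sites_iff[OF p] skip_def)
  next
    case (Suc i)
    have sk: "skip (t + 1) (Suc i) = Suc (skip t i)" by (simp add: skip_def)
    show ?thesis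
      unfolding Suc sk active_sites_iff[OF q] active_sites_iff[OF p]
      using blocked_insert_new_max_skip[OF P(4), of t i d] tn P(3) by (auto simp: Suc_le_eq)
  qed
  have new: "t + 1 \<in> active_sites d ?q \<longleftrightarrow> \<not> blocked d ?q t"
    using tn by (simp add: active_sites_iff[OF q])
  show ?thesis (is "?L = ?R")
  proof (rule set_eqI)
    fix u show "u \<in> ?L \<longleftrightarrow> u \<in> ?R"
    proof (cases "u = t + 1")
      case True
      moreover have "t + 1 \<notin> skip (t + 1) ` active_sites d p" by (metis imageE skip_neq)
      ultimately show ?thesis using new by simp
    next
      case False
      then obtain s where "u = skip (t + 1) s" by (rule skip_exhaust)
      then show ?thesis using old False by (auto simp: image_iff)
    qed
  qed
qed

lemma card_active_sites_insert_new_max: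
  assumes "p \<in> Av d n" "t \<in> active_sites d p"
  shows "card (active_sites d (insert_new_max p t)) =
           card (active_sites d p) + (if blocked d (insert_new_max p t) t then 0 else 1)"
proof -
  have "card (skip (t + 1) ` active_sites d p) = card (active_sites d p)"
    by (rule card_image) (simp add: inj_on_def)
  moreover have "t + 1 \<notin> skip (t + 1) ` active_sites d p"
    by (metis imageE skip_neq)
  ultimately show ?thesis
    unfolding active_sites_insert_new_max[OF assms] by simp
qed

lemma active_sites_left_of_new_max:
  assumes "p \<in> Av d n" "t \<in> active_sites d p"
  shows "active_sites d (insert_new_max p t) \<inter> {..<t} = active_sites d p \<inter> {..<t}"
  unfolding active_sites_insert_new_max[OF assms]
  by (auto simp: skip_def image_iff split: if_splits)

section \<open>A blocked new maximum forces a drop of the label\<close>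

lemma active_site_between:
  assumes p: "p \<in> Av d n" and ab: "a < b" "b < n" "p ! a < p ! b"
  shows "\<exists>s\<in>active_sites d p. a < s \<and> s \<le> b"
proof -
  have "\<exists>i. a \<le> i \<and> i < b \<and> p ! i < p ! (i + 1)"
  proof (rule ccontr)
    assume no: "\<not> ?thesis"
    have "p ! (a + m) \<le> p ! a" if "a + m \<le> b" for m
      using that
    proof (induction m)
      case (Suc m)
      then have "\<not> p ! (a + m) < p ! (a + m + 1)" using no by auto
      then show ?case using Suc by simp
    qed simp
    from this[of "b - a"] show False using ab by simp
  qed
  then obtain i where i: "a \<le> i" "i < b" "p ! i < p ! (i + 1)" by blast
  have "\<not> contains_sigma d p" using p by (simp add: Av_def)
  then have "\<not> blocked d p i" using i(3) unfolding contains_sigma_iff_blocked_ascent by blast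
  then have "i + 1 \<in> active_sites d p" using i ab by (simp add: active_sites_iff[OF p])
  then show ?thesis using i by (intro bexI[of _ "i + 1"]) auto
qed

text \<open>
  The blocking subsequence has to end in the previous maximum, at position \<open>s\<close>. The
  active sites that its \<open>d\<close> steps provide lie in \<open>{t<..s}\<close>. Together with \<open>t\<close> these are
  \<open>d + 1\<close> active sites in \<open>{t..s}\<close>, and at least \<open>d\<close> remain when \<open>s\<close> is dropped.
\<close>

lemma labels_if_blocked_by_previous_max:
  assumes p: "p \<in> Av d n" and t: "t \<in> active_sites d p"
    and s: "s < n" "p ! s = n"
    and b: "blocked d (insert_new_max p t) t"
  shows "card (active_sites d p \<inter> {..<t}) + d \<le> card (active_sites d p \<inter> {..<s})"
proof -
  let ?q = "insert_new_max p t" and ?A = "active_sites d p"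
  note P = Av_permutation[OF p]
  have tn: "t \<le> n" using t p active_sites_iff by blast
  obtain j where j: "t < j 0" "strict_mono_on {0..d} j"
      "j d < length ?q" "strict_mono_on {0..d} (\<lambda>m. ?q ! j m)" "?q ! j d + 1 = ?q ! t"
    using b unfolding blocked_def by blast
  have j0: "j 0 \<le> j m" if "m \<in> {0..d}" for m
    using strict_mono_on_leD[OF j(2), of 0 m] that by simp
  \<comment> \<open>All blocking entries lie to the right of \<open>t\<close>, so their positions in \<open>p\<close> are one less.\<close>
  define j' where "j' m = j m - 1" for m
  have jj': "j m = skip t (j' m)" if "m \<in> {0..d}" for m
    using j0[OF that] j(1) by (simp add: j'_def skip_def)
  have mono: "strict_mono_on {0..d} j'"
    using j(2) jj' by (simp add: strict_mono_on_def)
  have jd: "j' d < n" using j(3) jj'[of d] tn P by simp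
  have jm: "j' m < n" if "m \<in> {0..d}" for m
    using strict_mono_on_leD[OF mono that, of d] that jd by simp
  have val: "?q ! j m = p ! j' m" if "m \<in> {0..d}" for m
    using jm[OF that] tn jj'[OF that] P by simp
  have "p ! j' d = n" using j(5) val[of d] tn P by simp
  then have jds: "j' d = s" using s jd P nth_eq_iff_index_eq[of p "j' d" s] by simp
  have count: "m + 1 \<le> card (?A \<inter> {t..j' m})" if "m \<le> d" for m
    using that
  proof (induction m)
    case 0
    have "t \<le> j' 0" using j(1) by (simp add: j'_def)
    then have "t \<in> ?A \<inter> {t..j' 0}" using t by simp
    then have "0 < card (?A \<inter> {t..j' 0})" by (auto simp: card_gt_0_iff)
    then show ?case by simp
  next
    case (Suc m)
    have lt: "j' m < j' (Suc m)" using mono Suc.prems by (simp add: strict_mono_on_def)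
    have "p ! j' m < p ! j' (Suc m)"
      using j(4) val Suc.prems by (simp add: strict_mono_on_def)
    then obtain c where c: "c \<in> ?A" "j' m < c" "c \<le> j' (Suc m)"
      using active_site_between[OF p lt] jm[of "Suc m"] Suc.prems by auto
    have "t \<le> j' m" using j0[of m] j(1) Suc.prems by (simp add: j'_def)
    then have "insert c (?A \<inter> {t..j' m}) \<subseteq> ?A \<inter> {t..j' (Suc m)}" using c lt by auto
    then have "card (insert c (?A \<inter> {t..j' m})) \<le> card (?A \<inter> {t..j' (Suc m)})"
      by (intro card_mono) auto
    then show ?case using Suc c by simp
  qed
  have "d + 1 \<le> card (?A \<inter> {t..s})" using count[of d] jds by simp
  also have "\<dots> \<le> card (insert s (?A \<inter> {t..<s}))" by (intro card_mono) auto
  also have "\<dots> \<le> card (?A \<inter> {t..<s}) + 1" by (simp add: card_insert_if)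
  finally have d: "d \<le> card (?A \<inter> {t..<s})" by simp
  have "t \<le> s" using j0[of d] j(1) jds by (auto simp: j'_def)
  then have split: "?A \<inter> {..<s} = (?A \<inter> {..<t}) \<union> (?A \<inter> {t..<s})" by auto
  have "card (?A \<inter> {..<s}) = card (?A \<inter> {..<t}) + card (?A \<inter> {t..<s})"
    unfolding split by (rule card_Un_disjoint) auto
  then show ?thesis using d by simp
qed

section \<open>The map from sequences to permutations\<close>

lemma card_less_nth_sorted_list_of_set:
  fixes A :: "nat set"
  assumes "finite A" "a < card A"
  shows "card (A \<inter> {..<sorted_list_of_set A ! a}) = a"
proof -
  let ?l = "sorted_list_of_set A"
  have len: "length ?l = card A" and st: "set ?l = A" and di: "distinct ?l"
    using assms by auto
  have less: "?l ! i < ?l ! a \<longleftrightarrow> i < a" if "i < card A" for i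
    using sorted_wrt_nth_less[OF strict_sorted_list_of_set, of _ _ A] that assms(2) len
    by (metis linorder_neqE_nat order_less_asym)
  have "A \<inter> {..<?l ! a} = (\<lambda>i. ?l ! i) ` {..<a}"
  proof (intro set_eqI iffI)
    fix x assume x: "x \<in> A \<inter> {..<?l ! a}"
    then obtain i where "i < card A" "x = ?l ! i" using st len by (metis IntD1 in_set_conv_nth)
    then show "x \<in> (\<lambda>i. ?l ! i) ` {..<a}" using less x by auto
  next
    fix x assume "x \<in> (\<lambda>i. ?l ! i) ` {..<a}"
    then obtain i where "i < a" "x = ?l ! i" by auto
    then show "x \<in> A \<inter> {..<?l ! a}" using less[of i] assms(2) len st nth_mem[of i ?l] by auto
  qed
  moreover have "inj_on (\<lambda>i. ?l ! i) {..<a}"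
    using di assms(2) len by (auto simp: inj_on_def nth_eq_iff_index_eq)
  ultimately show ?thesis by (simp add: card_image)
qed

lemma pe_Nil [simp]: "pe d [] = Some []"
  by (simp add: pe_def)

lemma pe_snoc: "pe d (\<alpha> @ [a]) = Option.bind (pe d \<alpha>) (\<lambda>p. insert_at_label d p a)"
  by (simp add: pe_def)

lemma dasc_snoc:
  "dasc d (\<alpha> @ [a]) =
     dasc d \<alpha> + (if \<alpha> \<noteq> [] \<and> last \<alpha> < a + d then 1 else 0)"
proof -
  let ?S = "{k \<in> {1..<length \<alpha>}. int (\<alpha> ! k) > int (\<alpha> ! (k - 1)) - int d}"
  let ?T = "{k \<in> {1..<length (\<alpha> @ [a])}. int ((\<alpha> @ [a]) ! k) > int ((\<alpha> @ [a]) ! (k - 1)) - int d}"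
  have "?T = ?S \<union> (if \<alpha> \<noteq> [] \<and> last \<alpha> < a + d then {length \<alpha>} else {})"
    by (cases "\<alpha> = []") (auto simp: nth_append last_conv_nth less_Suc_eq)
  then have "card ?T = card (?S \<union> (if \<alpha> \<noteq> [] \<and> last \<alpha> < a + d then {length \<alpha>} else {}))"
    by simp
  also have "\<dots> = card ?S + (if \<alpha> \<noteq> [] \<and> last \<alpha> < a + d then 1 else 0)" by simp
  finally show ?thesis unfolding dasc_def .
qed

lemma d_ascent_seq_snoc:
  "d_ascent_seq d (\<alpha> @ [a]) \<longleftrightarrow>
     d_ascent_seq d \<alpha> \<and> (if \<alpha> = [] then a = 0 else a \<le> 1 + dasc d \<alpha>)"
proof (cases "\<alpha> = []")
  case False
  then have "{1..<length (\<alpha> @ [a])} = insert (length \<alpha>) {1..<length \<alpha>}"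
    by (auto simp: Suc_le_eq)
  then show ?thesis
    unfolding d_ascent_seq_def using False
    by (auto simp: nth_append hd_append)
qed (auto simp: d_ascent_seq_def)

text \<open>
  The induction needs, besides the number of active sites, that the last letter
  can be read off the permutation: a \<open>d\<close>-ascent compares the next letter with it, and as a count of
  the active sites to the left of the maximum it is comparable with the label of the next site.
\<close>

lemma pe_well_defined:
  assumes "d_ascent_seq d \<alpha>"
  shows "\<exists>p. pe d \<alpha> = Some p \<and> p \<in> Av d (length \<alpha>) \<and>
           (\<alpha> \<noteq> [] \<longrightarrow> 2 + dasc d \<alpha> \<le> card (active_sites d p) \<and>
             (\<exists>s<length \<alpha>. p ! s = length \<alpha> \<and> last \<alpha> = card (active_sites d p \<inter> {..<s})))"
  using assms
proof (induction \<alpha> rule: rev_induct)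
  case Nil
  have "\<not> contains_sigma d []" by (simp add: contains_sigma_def)
  then show ?case by (simp add: Av_def)
next
  case (snoc a \<alpha>)
  let ?n = "length \<alpha>"
  have asc: "d_ascent_seq d \<alpha>" and a: "if \<alpha> = [] then a = 0 else a \<le> 1 + dasc d \<alpha>"
    using snoc.prems unfolding d_ascent_seq_snoc by auto
  obtain p where p: "pe d \<alpha> = Some p" "p \<in> Av d ?n" and
    ne: "\<alpha> \<noteq> [] \<Longrightarrow> 2 + dasc d \<alpha> \<le> card (active_sites d p) \<and>
             (\<exists>s<?n. p ! s = ?n \<and> last \<alpha> = card (active_sites d p \<inter> {..<s}))"
    using snoc.IH[OF asc] by blast
  have "0 \<in> active_sites d p" by (simp add: active_sites_iff[OF p(2)])
  then have pos: "0 < card (active_sites d p)" by (auto simp: card_gt_0_iff)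
  have lab: "a < card (active_sites d p)" using a ne pos by (auto split: if_splits)
  define t where "t = sorted_list_of_set (active_sites d p) ! a"
  have t: "t \<in> active_sites d p"
    unfolding t_def using lab nth_mem[of a "sorted_list_of_set (active_sites d p)"] by simp
  have cardt: "card (active_sites d p \<inter> {..<t}) = a"
    unfolding t_def by (rule card_less_nth_sorted_list_of_set) (use lab in auto)
  let ?q = "insert_new_max p t"
  have tn: "t \<le> ?n" and len: "length p = ?n"
    using t active_sites_iff[OF p(2)] Av_permutation[OF p(2)] by auto
  have "pe d (\<alpha> @ [a]) = Some ?q"
    unfolding pe_snoc p(1) using lab by (simp add: insert_at_label_def t_def)
  moreover have "?q \<in> Av d (length (\<alpha> @ [a]))"
    using insert_at_active_site_in_Av[OF p(2) t] by simp
  moreover have "2 + dasc d (\<alpha> @ [a]) \<le> card (active_sites d ?q)"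
  proof (cases "\<alpha> = []")
    case True
    then have "\<not> blocked d ?q t" using len tn by (simp add: blocked_def strict_mono_on_def)
      (metis bot_nat_0.extremum gr_implies_not0 le_refl less_Suc0 nat_less_le)
    then show ?thesis
      using True pos card_active_sites_insert_new_max[OF p(2) t]
      by (simp add: dasc_def)
  next
    case False
    obtain s where s: "s < ?n" "p ! s = ?n" "last \<alpha> = card (active_sites d p \<inter> {..<s})"
      using ne[OF False] by blast
    have "a + d \<le> last \<alpha>" if "blocked d ?q t"
      using labels_if_blocked_by_previous_max[OF p(2) t s(1,2) that] s(3) cardt by simp
    then show ?thesis
      using ne[OF False] card_active_sites_insert_new_max[OF p(2) t]
      by (auto simp: dasc_snoc)
  qed
  moreover have "\<exists>s<length (\<alpha> @ [a]). ?q ! s = length (\<alpha> @ [a]) \<and>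
      last (\<alpha> @ [a]) = card (active_sites d ?q \<inter> {..<s})"
    using tn len cardt active_sites_left_of_new_max[OF p(2) t] by (intro exI[of _ t]) simp
  ultimately show ?case by blast
qed

lemma insert_at_label_inject:
  assumes p: "p \<in> Av d n" and q: "q \<in> Av d n"
    and r: "insert_at_label d p a = Some r" "insert_at_label d q b = Some r"
  shows "p = q \<and> a = b"
proof -
  let ?s = "sorted_list_of_set (active_sites d p) ! a"
  let ?t = "sorted_list_of_set (active_sites d q) ! b"
  have a: "a < card (active_sites d p)" "insert_new_max p ?s = r"
    and b: "b < card (active_sites d q)" "insert_new_max q ?t = r"
    using r by (auto simp: insert_at_label_def split: if_splits)
  have "?s \<in> active_sites d p"
    using a(1) nth_mem[of a "sorted_list_of_set (active_sites d p)"] by simp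
  moreover have "?t \<in> active_sites d q"
    using b(1) nth_mem[of b "sorted_list_of_set (active_sites d q)"] by simp
  ultimately have le: "?s \<le> length p" "?t \<le> length q" by (auto simp: active_sites_def)
  have eq: "p = q \<and> ?s = ?t"
  proof (rule insert_new_max_inject[OF _ _ le])
    show "insert_new_max p ?s = insert_new_max q ?t" using a(2) b(2) by simp
  qed (use Av_permutation(1,3)[OF p] Av_permutation(1,3)[OF q] in auto)
  let ?l = "sorted_list_of_set (active_sites d p)"
  have "?l ! a = ?l ! b" "a < length ?l" "b < length ?l" using eq a(1) b(1) by auto
  then have "a = b" using nth_eq_iff_index_eq[of ?l a b] by simp
  then show ?thesis using eq by simp
qed

lemma pe_inject:
  assumes "d_ascent_seq d \<alpha>" "d_ascent_seq d \<beta>" "length \<alpha> = length \<beta>" "pe d \<alpha> = pe d \<beta>"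
  shows "\<alpha> = \<beta>"
  using assms
proof (induction \<alpha> arbitrary: \<beta> rule: rev_induct)
  case Nil
  then show ?case by simp
next
  case (snoc a \<alpha>)
  obtain \<beta>' b where \<beta>: "\<beta> = \<beta>' @ [b]" using snoc.prems(3) by (cases \<beta> rule: rev_cases) auto
  have asc: "d_ascent_seq d \<alpha>" "d_ascent_seq d \<beta>'" and len: "length \<alpha> = length \<beta>'"
    using snoc.prems \<beta> by (auto simp: d_ascent_seq_snoc)
  obtain p q where p: "pe d \<alpha> = Some p" "p \<in> Av d (length \<alpha>)"
    and q: "pe d \<beta>' = Some q" "q \<in> Av d (length \<alpha>)"
    using pe_well_defined[OF asc(1)] pe_well_defined[OF asc(2)] len by metis
  obtain r where r: "pe d (\<alpha> @ [a]) = Some r" using pe_well_defined[OF snoc.prems(1)] by blast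
  have "insert_at_label d p a = Some r" "insert_at_label d q b = Some r"
    using r snoc.prems(4) p(1) q(1) \<beta> by (auto simp: pe_snoc)
  then have "p = q" "a = b" using insert_at_label_inject[OF p(2) q(2)] by auto
  moreover have "\<alpha> = \<beta>'" using snoc.IH[OF asc len] p q \<open>p = q\<close> by simp
  ultimately show ?case using \<beta> by simp
qed

theorem theorem4p5:
  fixes d n :: nat
  shows "(\<forall>\<alpha>\<in>dA d n. \<exists>\<pi>\<in>Av d n. pe d \<alpha> = Some \<pi>) \<and> inj_on (pe d) (dA d n)"
proof
  show "\<forall>\<alpha>\<in>dA d n. \<exists>\<pi>\<in>Av d n. pe d \<alpha> = Some \<pi>"
    using pe_well_defined unfolding dA_def by blast
  show "inj_on (pe d) (dA d n)"
    using pe_inject unfolding dA_def inj_on_def by blast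
qed

end
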